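(* Let $(C,A;\sigma_{C,C},\sigma_{A,A},\sigma_{C,A})$ be a rank $2$ braided system in a strict monoidal category $(\mathcal C,\otimes,\mathbf I)$, let $\mathcal Z_A^C$ be its category of enriching structures and $\mathcal{YD}_A^C$ its category of Yetter-Drinfel'd modules. (1) The category $\mathcal Z_A^C$ is strict monoidal: the tensor product is that of $\mathcal C$, together with $$\sigma_{C,M\otimes M'}=(M\otimes\sigma_{C,M'})\circ(\sigma_{C,M}\otimes M'),\qquad \sigma_{M\otimes M',A}=(\sigma_{M,A}\otimes M')\circ(M\otimes\sigma_{M',A}),$$ and the unit object is $\mathbf I$ with $\sigma_{C,\mathbf I}=\mathrm{Id}_C$, $\sigma_{\mathbf I,A}=\mathrm{Id}_A$. (2) The category $\mathcal Z_A^C$ contains $(A,\sigma_{C,A},\sigma_{A,A})$ and $(C,\sigma_{C,C},\sigma_{C,A})$, as well as all their mixed tensor products. (3) The assignment sending a YD module $(N,\rho,\delta)$ and an enriching structure $(M,\sigma_{C,M},\sigma_{M,A})$ to $N\otimes M$ with action $(\rho\otimes M)\circ(N\otimes\sigma_{M,A})$ and coaction $(N\otimes\sigma_{C,M})\circ(\delta\otimes M)$, and a pair of morphisms $\varphi\times\psi$ to $\varphi\otimes\psi$, is a bifunctor $E_A^C\colon\mathcal{YD}_A^C\times\mathcal Z_A^C\to\mathcal{YD}_A^C$.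
   Context: An object's name also denotes its identity morphism. A rank $r$ braided system is an ordered family $V_1,\dots,V_r$ with morphisms $\sigma_{i,j}\colon V_i\otimes V_j\to V_j\otimes V_i$, $1\le i\le j\le r$ (not necessarily invertible), satisfying for all $i\le j\le k$: $(\sigma_{j,k}\otimes V_i)\circ(V_j\otimes\sigma_{i,k})\circ(\sigma_{i,j}\otimes V_k)=(V_k\otimes\sigma_{i,j})\circ(\sigma_{i,k}\otimes V_j)\circ(V_i\otimes\sigma_{j,k})$. $\mathcal{YD}_A^C$: objects $(N,\rho\colon N\otimes A\to N,\delta\colon N\to N\otimes C)$ with $\rho(\rho\otimes A)=\rho(\rho\otimes A)(N\otimes\sigma_{A,A})$, $(\delta\otimes C)\delta=(N\otimes\sigma_{C,C})(\delta\otimes C)\delta$, $\delta\rho=(\rho\otimes C)(N\otimes\sigma_{C,A})(\delta\otimes A)$; morphisms commute with $\rho$ and $\delta$. $\mathcal Z_A^C$: objects are enriching structures, i.e. objects $M$ of $\mathcal C$ with morphisms $\sigma_{C,M}\colon C\otimes M\to M\otimes C$ and $\sigma_{M,A}\colon M\otimes A\to A\otimes M$ such that $(C,M,A)$ with $\sigma_{C,C},\sigma_{A,A},\sigma_{C,A},\sigma_{C,M},\sigma_{M,M}=\mathrm{Id}_{M\otimes M},\sigma_{M,A}$ is a rank $3$ braided system; morphisms $M\to M'$ are morphisms $\varphi$ in $\mathcal C$ with $(\varphi\otimes C)\circ\sigma_{C,M}=\sigma_{C,M'}\circ(C\otimes\varphi)$ and $(A\otimes\varphi)\circ\sigma_{M,A}=\sigma_{M',A}\circ(\varphi\otimes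 A)$. *)

theory Defs
  imports Main
begin

section \<open>Categories, functors and strict monoidal categories\<close>

text \<open>
  Only the values of the operations on objects, morphisms and composable pairs matter;
  elsewhere they are unconstrained.
\<close>

record ('o, 'm) cat =
  Obj :: "'o set"
  Arr :: "'m set"
  Dom :: "'m \<Rightarrow> 'o"
  Cod :: "'m \<Rightarrow> 'o"
  Ident :: "'o \<Rightarrow> 'm"
  Comp :: "'m \<Rightarrow> 'm \<Rightarrow> 'm"  (infixr \<open>\<cdot>\<index>\<close> 55)

definition hom :: "('o, 'm, 'z) cat_scheme \<Rightarrow> 'o \<Rightarrow> 'o \<Rightarrow> 'm set" where
  "hom K X Y = {f \<in> Arr K. Dom K f = X \<and> Cod K f = Y}"

locale category =
  fixes K :: "('o, 'm, 'z) cat_scheme" (structure)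
  assumes Dom_in_Obj: "f \<in> Arr K \<Longrightarrow> Dom K f \<in> Obj K"
    and Cod_in_Obj: "f \<in> Arr K \<Longrightarrow> Cod K f \<in> Obj K"
    and Ident_in_hom: "X \<in> Obj K \<Longrightarrow> Ident K X \<in> hom K X X"
    and Comp_in_hom: "\<lbrakk>f \<in> hom K X Y; g \<in> hom K Y Z\<rbrakk> \<Longrightarrow> g \<cdot> f \<in> hom K X Z"
    and Ident_left: "f \<in> hom K X Y \<Longrightarrow> Ident K Y \<cdot> f = f"
    and Ident_right: "f \<in> hom K X Y \<Longrightarrow> f \<cdot> Ident K X = f"
    and Comp_assoc:
      "\<lbrakk>f \<in> hom K W X; g \<in> hom K X Y; h \<in> hom K Y Z\<rbrakk> \<Longrightarrow> (h \<cdot> g) \<cdot> f = h \<cdot> (g \<cdot> f)"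

definition prod_cat ::
  "('o, 'm, 'z) cat_scheme \<Rightarrow> ('p, 'n, 'y) cat_scheme \<Rightarrow> ('o \<times> 'p, 'm \<times> 'n) cat" where
  "prod_cat K L =
    \<lparr>Obj = Obj K \<times> Obj L,
     Arr = Arr K \<times> Arr L,
     Dom = map_prod (Dom K) (Dom L),
     Cod = map_prod (Cod K) (Cod L),
     Ident = map_prod (Ident K) (Ident L),
     Comp = (\<lambda>(g, g') (f, f'). (Comp K g f, Comp L g' f'))\<rparr>"

locale cat_functor = dom: category K + cod: category L
  for K :: "('o, 'm, 'z) cat_scheme" and L :: "('p, 'n, 'y) cat_scheme" +
  fixes F_ob :: "'o \<Rightarrow> 'p" and F_ar :: "'m \<Rightarrow> 'n"
  assumes F_Obj: "X \<in> Obj K \<Longrightarrow> F_ob X \<in> Obj L"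
    and F_hom: "f \<in> hom K X Y \<Longrightarrow> F_ar f \<in> hom L (F_ob X) (F_ob Y)"
    and F_Ident: "X \<in> Obj K \<Longrightarrow> F_ar (Ident K X) = Ident L (F_ob X)"
    and F_Comp: "\<lbrakk>f \<in> hom K X Y; g \<in> hom K Y Z\<rbrakk> \<Longrightarrow>
      F_ar (Comp K g f) = Comp L (F_ar g) (F_ar f)"

abbreviation bifunctor ::
  "('o, 'm, 'z) cat_scheme \<Rightarrow> ('p, 'n, 'y) cat_scheme \<Rightarrow> ('q, 'k, 'x) cat_scheme \<Rightarrow>
    ('o \<Rightarrow> 'p \<Rightarrow> 'q) \<Rightarrow> ('m \<Rightarrow> 'n \<Rightarrow> 'k) \<Rightarrow> bool" where
  "bifunctor K L Q F_ob F_ar \<equiv>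
    category K \<and> category L \<and> cat_functor (prod_cat K L) Q (case_prod F_ob) (case_prod F_ar)"

record ('o, 'm) mon_cat = "('o, 'm) cat" +
  TensO :: "'o \<Rightarrow> 'o \<Rightarrow> 'o"  (infixr \<open>\<otimes>\<index>\<close> 70)
  TensA :: "'m \<Rightarrow> 'm \<Rightarrow> 'm"  (infixr \<open>\<boxtimes>\<index>\<close> 70)
  TUnit :: 'o  (\<open>\<I>\<index>\<close>)

locale strict_monoidal_category = category K
  for K :: "('o, 'm, 'z) mon_cat_scheme" (structure) +
  assumes tensor_bifunctor: "bifunctor K K K (TensO K) (TensA K)"
    and TUnit_in_Obj: "\<I> \<in> Obj K"
    and TensO_assoc:
      "\<lbrakk>X \<in> Obj K; Y \<in> Obj K; Z \<in> Obj K\<rbrakk> \<Longrightarrow> (X \<otimes> Y) \<otimes> Z = X \<otimes> (Y \<otimes> Z)"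
    and TensA_assoc:
      "\<lbrakk>f \<in> Arr K; g \<in> Arr K; h \<in> Arr K\<rbrakk> \<Longrightarrow> (f \<boxtimes> g) \<boxtimes> h = f \<boxtimes> (g \<boxtimes> h)"
    and TensO_unit_left: "X \<in> Obj K \<Longrightarrow> \<I> \<otimes> X = X"
    and TensO_unit_right: "X \<in> Obj K \<Longrightarrow> X \<otimes> \<I> = X"
    and TensA_unit_left: "f \<in> Arr K \<Longrightarrow> Ident K \<I> \<boxtimes> f = f"
    and TensA_unit_right: "f \<in> Arr K \<Longrightarrow> f \<boxtimes> Ident K \<I> = f"

abbreviation whisker_left :: "('o, 'm, 'z) mon_cat_scheme \<Rightarrow> 'o \<Rightarrow> 'm \<Rightarrow> 'm"
    (infixr \<open>\<rhd>\<index>\<close> 70) where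
  "X \<rhd>\<^bsub>K\<^esub> f \<equiv> TensA K (Ident K X) f"

abbreviation whisker_right :: "('o, 'm, 'z) mon_cat_scheme \<Rightarrow> 'm \<Rightarrow> 'o \<Rightarrow> 'm"
    (infixl \<open>\<lhd>\<index>\<close> 70) where
  "f \<lhd>\<^bsub>K\<^esub> X \<equiv> TensA K f (Ident K X)"

definition tensor_list :: "('o, 'm, 'z) mon_cat_scheme \<Rightarrow> 'o list \<Rightarrow> 'o" where
  "tensor_list K Xs = foldr (TensO K) Xs (TUnit K)"


section \<open>Braided systems\<close>

definition braided_system ::
  "('o, 'm, 'z) mon_cat_scheme \<Rightarrow> nat \<Rightarrow> (nat \<Rightarrow> 'o) \<Rightarrow> (nat \<Rightarrow> nat \<Rightarrow> 'm) \<Rightarrow> bool" where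
  "braided_system K r V \<sigma> \<longleftrightarrow>
    (\<forall>i\<in>{1..r}. V i \<in> Obj K) \<and>
    (\<forall>i j. 1 \<le> i \<and> i \<le> j \<and> j \<le> r \<longrightarrow>
      \<sigma> i j \<in> hom K (V i \<otimes>\<^bsub>K\<^esub> V j) (V j \<otimes>\<^bsub>K\<^esub> V i)) \<and>
    (\<forall>i j k. 1 \<le> i \<and> i \<le> j \<and> j \<le> k \<and> k \<le> r \<longrightarrow>
      (\<sigma> j k \<lhd>\<^bsub>K\<^esub> V i) \<cdot>\<^bsub>K\<^esub> (V j \<rhd>\<^bsub>K\<^esub> \<sigma> i k) \<cdot>\<^bsub>K\<^esub> (\<sigma> i j \<lhd>\<^bsub>K\<^esub> V k) =
      (V k \<rhd>\<^bsub>K\<^esub> \<sigma> i j) \<cdot>\<^bsub>K\<^esub> (\<sigma> i k \<lhd>\<^bsub>K\<^esub> V j) \<cdot>\<^bsub>K\<^esub> (V i \<rhd>\<^bsub>K\<^esub> \<sigma> j k))"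

definition braided_system2 ::
  "('o, 'm, 'z) mon_cat_scheme \<Rightarrow> 'o \<Rightarrow> 'o \<Rightarrow> 'm \<Rightarrow> 'm \<Rightarrow> 'm \<Rightarrow> bool" where
  "braided_system2 K C A \<sigma>CC \<sigma>AA \<sigma>CA \<longleftrightarrow>
    braided_system K 2
      (\<lambda>i. if i = 1 then C else A)
      (\<lambda>i j. if (i, j) = (1, 1) then \<sigma>CC
             else if (i, j) = (1, 2) then \<sigma>CA
             else \<sigma>AA)"


section \<open>Enriching structures and Yetter-Drinfel'd modules\<close>

datatype ('o, 'm) enr = Enr (enr_ob: 'o) (enr_C: 'm) (enr_A: 'm)

datatype ('o, 'm) yd = YD (yd_ob: 'o) (yd_act: 'm) (yd_coact: 'm)

text \<open>
  A morphism between structured objects is an underlying morphism tagged with its source and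
  target, since the same underlying morphism may connect many structured objects.
\<close>

datatype ('x, 'm) mor = Mor (mor_src: 'x) (mor_und: 'm) (mor_tgt: 'x)

context
  fixes K :: "('o, 'm, 'z) mon_cat_scheme" (structure)
    and C A :: 'o
    and \<sigma>CC \<sigma>AA \<sigma>CA :: 'm
begin

definition is_enriching :: "('o, 'm) enr \<Rightarrow> bool" where
  "is_enriching E \<longleftrightarrow>
    braided_system K 3
      (\<lambda>i. if i = 1 then C else if i = 2 then enr_ob E else A)
      (\<lambda>i j. if (i, j) = (1, 1) then \<sigma>CC
             else if (i, j) = (1, 2) then enr_C E
             else if (i, j) = (1, 3) then \<sigma>CA
             else if (i, j) = (2, 2) then Ident K (enr_ob E \<otimes> enr_ob E)
             else if (i, j) = (2, 3) then enr_A E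
             else \<sigma>AA)"

definition is_enr_mor :: "('o, 'm) enr \<Rightarrow> 'm \<Rightarrow> ('o, 'm) enr \<Rightarrow> bool" where
  "is_enr_mor E f E' \<longleftrightarrow>
    f \<in> hom K (enr_ob E) (enr_ob E') \<and>
    (f \<lhd> C) \<cdot> enr_C E = enr_C E' \<cdot> (C \<rhd> f) \<and>
    (A \<rhd> f) \<cdot> enr_A E = enr_A E' \<cdot> (f \<lhd> A)"

definition enr_tensor :: "('o, 'm) enr \<Rightarrow> ('o, 'm) enr \<Rightarrow> ('o, 'm) enr" where
  "enr_tensor E E' =
    Enr (enr_ob E \<otimes> enr_ob E')
        ((enr_ob E \<rhd> enr_C E') \<cdot> (enr_C E \<lhd> enr_ob E'))
        ((enr_A E \<lhd> enr_ob E') \<cdot> (enr_ob E \<rhd> enr_A E'))"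

definition enr_cat :: "(('o, 'm) enr, (('o, 'm) enr, 'm) mor) mon_cat" where
  "enr_cat =
    \<lparr>Obj = {E. is_enriching E},
     Arr = {Mor E f E' | E f E'. is_enriching E \<and> is_enriching E' \<and> is_enr_mor E f E'},
     Dom = mor_src,
     Cod = mor_tgt,
     Ident = (\<lambda>E. Mor E (Ident K (enr_ob E)) E),
     Comp = (\<lambda>g f. Mor (mor_src f) (mor_und g \<cdot> mor_und f) (mor_tgt g)),
     TensO = enr_tensor,
     TensA = (\<lambda>f g. Mor (enr_tensor (mor_src f) (mor_src g))
                         (mor_und f \<boxtimes> mor_und g)
                         (enr_tensor (mor_tgt f) (mor_tgt g))),
     TUnit = Enr \<I> (Ident K C) (Ident K A)\<rparr>"

definition is_yd :: "('o, 'm) yd \<Rightarrow> bool" where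
  "is_yd Y \<longleftrightarrow>
    (let N = yd_ob Y; \<rho> = yd_act Y; \<delta> = yd_coact Y in
      N \<in> Obj K \<and> \<rho> \<in> hom K (N \<otimes> A) N \<and> \<delta> \<in> hom K N (N \<otimes> C) \<and>
      \<rho> \<cdot> (\<rho> \<lhd> A) = \<rho> \<cdot> (\<rho> \<lhd> A) \<cdot> (N \<rhd> \<sigma>AA) \<and>
      (\<delta> \<lhd> C) \<cdot> \<delta> = (N \<rhd> \<sigma>CC) \<cdot> (\<delta> \<lhd> C) \<cdot> \<delta> \<and>
      \<delta> \<cdot> \<rho> = (\<rho> \<lhd> C) \<cdot> (N \<rhd> \<sigma>CA) \<cdot> (\<delta> \<lhd> A))"

definition is_yd_mor :: "('o, 'm) yd \<Rightarrow> 'm \<Rightarrow> ('o, 'm) yd \<Rightarrow> bool" where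
  "is_yd_mor Y f Y' \<longleftrightarrow>
    f \<in> hom K (yd_ob Y) (yd_ob Y') \<and>
    f \<cdot> yd_act Y = yd_act Y' \<cdot> (f \<lhd> A) \<and>
    (f \<lhd> C) \<cdot> yd_coact Y = yd_coact Y' \<cdot> f"

definition yd_cat :: "(('o, 'm) yd, (('o, 'm) yd, 'm) mor) cat" where
  "yd_cat =
    \<lparr>Obj = {Y. is_yd Y},
     Arr = {Mor Y f Y' | Y f Y'. is_yd Y \<and> is_yd Y' \<and> is_yd_mor Y f Y'},
     Dom = mor_src,
     Cod = mor_tgt,
     Ident = (\<lambda>Y. Mor Y (Ident K (yd_ob Y)) Y),
     Comp = (\<lambda>g f. Mor (mor_src f) (mor_und g \<cdot> mor_und f) (mor_tgt g))\<rparr>"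

definition yd_enr_ob :: "('o, 'm) yd \<Rightarrow> ('o, 'm) enr \<Rightarrow> ('o, 'm) yd" where
  "yd_enr_ob Y E =
    YD (yd_ob Y \<otimes> enr_ob E)
       ((yd_act Y \<lhd> enr_ob E) \<cdot> (yd_ob Y \<rhd> enr_A E))
       ((yd_ob Y \<rhd> enr_C E) \<cdot> (yd_coact Y \<lhd> enr_ob E))"

definition yd_enr_ar ::
  "(('o, 'm) yd, 'm) mor \<Rightarrow> (('o, 'm) enr, 'm) mor \<Rightarrow> (('o, 'm) yd, 'm) mor" where
  "yd_enr_ar f g =
    Mor (yd_enr_ob (mor_src f) (mor_src g))
        (mor_und f \<boxtimes> mor_und g)
        (yd_enr_ob (mor_tgt f) (mor_tgt g))"

end

end

theory Submission
  imports Defs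
begin

text \<open>
  An enriching structure on \<open>M\<close> says that \<open>M\<close> can be moved across a strand \<open>C\<close> and a
  strand \<open>A\<close>. Since \<open>\<sigma>\<^sub>M\<^sub>M\<close> is the identity, every instance of the braid relation
  with two or more strands \<open>M\<close> is trivial. Three instances remain, of shapes
  \<open>C C M\<close>, \<open>C M A\<close> and \<open>M A A\<close>, together with those of the given rank 2 system
  (\<open>enriching_iff\<close>).

  For \<open>M \<otimes> M'\<close> one moves the two strands one after the other. Each of the three relations is
  a Yang-Baxter equation in which one of the three positions is occupied by a tensor product. It
  follows from the equations of the two factors because crossings on disjoint strands
  commute, which is the interchange law; hence one lemma for each position,
  \<open>yang_baxter_third\<close>, \<open>yang_baxter_middle\<close> and \<open>yang_baxter_first\<close>. The objects \<open>A\<close> and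
  \<open>C\<close> are enriching structures because the relations of shapes \<open>C C A\<close>, \<open>C A A\<close>, \<open>A A A\<close>,
  respectively \<open>C C C\<close>, \<open>C C A\<close>, \<open>C A A\<close>, are those of the rank 2 system; mixed tensor
  products are then covered by closure under \<open>\<otimes>\<close>.

  For a Yetter-Drinfel'd module \<open>N\<close>, the action of \<open>N \<otimes> M\<close> carries \<open>A\<close> to the left through
  \<open>M\<close> and lets it act on \<open>N\<close>; the coaction emits \<open>C\<close> from \<open>N\<close> and carries it to the right
  through \<open>M\<close>. Interchange separates what happens at \<open>N\<close> from what happens at \<open>M\<close>, so each
  axiom for \<open>N \<otimes> M\<close> combines the same axiom for \<open>N\<close> with one braid relation for \<open>M\<close>:
  \<open>M A A\<close> for the action, \<open>C C M\<close> for the coaction, and \<open>C M A\<close> for their compatibility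
  (\<open>yetter_drinfeld_tensor\<close>).

  On morphisms both the tensor product of enriching structures and the functor \<open>E\<close> are
  \<open>\<boxtimes>\<close> of underlying morphisms. Functoriality is inherited from the base category
  (\<open>tensor_lifts_to_bifunctor\<close>), and compatibility with the structure maps is naturality of a
  composite of two natural structure maps (\<open>tensor_natural_outgoing\<close>, \<open>tensor_natural_incoming\<close>).
\<close>

section \<open>Whisker calculus in a strict monoidal category\<close>

text \<open>
  The axioms of a category mention hom-sets whose middle objects a rewriting step would have to
  guess. Phrased with \<open>Arr\<close>, \<open>Dom\<close> and \<open>Cod\<close>, all side conditions can be discharged by
  rewriting.
\<close>

context category
begin

lemma hom_iff: "f \<in> hom K X Y \<longleftrightarrow> f \<in> Arr K \<and> Dom K f = X \<and> Cod K f = Y"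
  by (simp add: hom_def)

lemma Ident_Arr [simp]:
  assumes "X \<in> Obj K"
  shows "Ident K X \<in> Arr K" "Dom K (Ident K X) = X" "Cod K (Ident K X) = X"
  using Ident_in_hom[OF assms] by (simp_all add: hom_iff)

lemma Comp_Arr [simp]:
  assumes "f \<in> Arr K" "g \<in> Arr K" "Cod K f = Dom K g"
  shows "g \<cdot> f \<in> Arr K" "Dom K (g \<cdot> f) = Dom K f" "Cod K (g \<cdot> f) = Cod K g"
  using Comp_in_hom[of f "Dom K f" "Cod K f" g "Cod K g"] assms by (simp_all add: hom_iff)

lemma Comp_Ident [simp]:
  assumes "f \<in> Arr K"
  shows "Cod K f = Y \<Longrightarrow> Ident K Y \<cdot> f = f" "Dom K f = X \<Longrightarrow> f \<cdot> Ident K X = f"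
  using assms Ident_left[of f X Y] Ident_left[of f "Dom K f" "Cod K f"]
    Ident_right[of f "Dom K f" "Cod K f"]
  by (simp_all add: hom_iff)

lemma Comp_assoc_Arr [simp]:
  assumes "f \<in> Arr K" "g \<in> Arr K" "h \<in> Arr K" "Cod K f = Dom K g" "Cod K g = Dom K h"
  shows "(h \<cdot> g) \<cdot> f = h \<cdot> g \<cdot> f"
  using assms Comp_assoc[of f "Dom K f" "Cod K f" g "Cod K g" h "Cod K h"]
  by (simp add: hom_iff)

lemmas Arr_Obj [simp] = Dom_in_Obj Cod_in_Obj

end

context strict_monoidal_category
begin

lemma tensor_functor: "cat_functor (prod_cat K K) K (case_prod (TensO K)) (case_prod (TensA K))"
  using tensor_bifunctor by simp

lemma TensO_Obj [simp]: "X \<in> Obj K \<Longrightarrow> Y \<in> Obj K \<Longrightarrow> X \<otimes> Y \<in> Obj K"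
  using cat_functor.F_Obj[OF tensor_functor, of "(X, Y)"] by (simp add: prod_cat_def)

lemma TensA_Arr [simp]:
  assumes "f \<in> Arr K" "g \<in> Arr K"
  shows "f \<boxtimes> g \<in> Arr K" "Dom K (f \<boxtimes> g) = Dom K f \<otimes> Dom K g"
    "Cod K (f \<boxtimes> g) = Cod K f \<otimes> Cod K g"
  using cat_functor.F_hom[OF tensor_functor,
      of "(f, g)" "(Dom K f, Dom K g)" "(Cod K f, Cod K g)"] assms
  by (simp_all add: prod_cat_def hom_def)

text \<open>
  Together with associativity of \<open>\<boxtimes>\<close> and \<open>whisker_Comp\<close> below, splitting identities of tensor
  products into factors brings every composite of whiskered morphisms into a normal form. Two
  composites that agree without an interchange of distinct crossings are then equal by
  simplification. The interchange law itself has no preferred direction and is applied by hand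
  (\<open>slide\<close>). Where a composite consists of identities, the rule is used from right to left, so
  that they are recognised as identities and cancelled.
\<close>

lemma Ident_TensO [simp]:
  "X \<in> Obj K \<Longrightarrow> Y \<in> Obj K \<Longrightarrow> Ident K (X \<otimes> Y) = Ident K X \<boxtimes> Ident K Y"
  using cat_functor.F_Ident[OF tensor_functor, of "(X, Y)"] by (simp add: prod_cat_def)

lemma interchange:
  assumes "f \<in> Arr K" "g \<in> Arr K" "f' \<in> Arr K" "g' \<in> Arr K"
    "Cod K f = Dom K g" "Cod K f' = Dom K g'"
  shows "(g \<boxtimes> g') \<cdot> (f \<boxtimes> f') = (g \<cdot> f) \<boxtimes> (g' \<cdot> f')"
  using cat_functor.F_Comp[OF tensor_functor, of "(f, f')" "(Dom K f, Dom K f')"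
      "(Cod K f, Cod K f')" "(g, g')" "(Cod K g, Cod K g')"] assms
  by (simp add: prod_cat_def hom_def)

lemmas strict_simps [simp] =
  TUnit_in_Obj TensO_assoc TensA_assoc TensO_unit_left TensO_unit_right
  TensA_unit_left TensA_unit_right

lemma whisker_Comp [simp]:
  assumes "X \<in> Obj K" "f \<in> Arr K" "g \<in> Arr K" "Cod K f = Dom K g"
  shows "X \<rhd> (g \<cdot> f) = (X \<rhd> g) \<cdot> (X \<rhd> f)" "(g \<cdot> f) \<lhd> X = (g \<lhd> X) \<cdot> (f \<lhd> X)"
  using assms by (simp_all add: interchange)

text \<open>
  Morphisms on disjoint strands commute: both sides are \<open>f \<boxtimes> g\<close>.
\<close>

lemma slide:
  assumes "f \<in> hom K X Y" "g \<in> hom K Z W"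
  shows "(Y \<rhd> g) \<cdot> (f \<lhd> Z) = (f \<lhd> W) \<cdot> (X \<rhd> g)"
proof -
  from assms have *: "f \<in> Arr K" "g \<in> Arr K" "X = Dom K f" "Y = Cod K f" "Z = Dom K g" "W = Cod K g"
    by (simp_all add: hom_iff)
  have "(Y \<rhd> g) \<cdot> (f \<lhd> Z) = f \<boxtimes> g"
    using * by (subst interchange) simp_all
  moreover have "(f \<lhd> W) \<cdot> (X \<rhd> g) = f \<boxtimes> g"
    using * by (subst interchange) simp_all
  ultimately show ?thesis by simp
qed

end


section \<open>The Yang-Baxter equation and tensor products\<close>

definition yang_baxter ::
  "('o, 'm, 'z) mon_cat_scheme \<Rightarrow> 'o \<Rightarrow> 'o \<Rightarrow> 'o \<Rightarrow> 'm \<Rightarrow> 'm \<Rightarrow> 'm \<Rightarrow> bool" where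
  "yang_baxter K X Y Z a b c \<longleftrightarrow>
    (c \<lhd>\<^bsub>K\<^esub> X) \<cdot>\<^bsub>K\<^esub> (Y \<rhd>\<^bsub>K\<^esub> b) \<cdot>\<^bsub>K\<^esub> (a \<lhd>\<^bsub>K\<^esub> Z) =
    (Z \<rhd>\<^bsub>K\<^esub> a) \<cdot>\<^bsub>K\<^esub> (b \<lhd>\<^bsub>K\<^esub> Y) \<cdot>\<^bsub>K\<^esub> (X \<rhd>\<^bsub>K\<^esub> c)"

context strict_monoidal_category
begin

text \<open>
  The crossings of \<open>Y\<close> with \<open>Z\<close> and of \<open>X\<close> with \<open>Z'\<close> are disjoint. Exchanging them groups all
  crossings with \<open>Z\<close> next to \<open>a\<close>, so that \<open>a\<close> can be pulled first through \<open>Z\<close> and then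
  through \<open>Z'\<close>. A second exchange restores the order of the crossings.
\<close>

lemma yang_baxter_third:
  assumes obj: "X \<in> Obj K" "Y \<in> Obj K" "Z \<in> Obj K" "Z' \<in> Obj K"
    and a: "a \<in> hom K (X \<otimes> Y) (Y \<otimes> X)"
    and b: "b \<in> hom K (X \<otimes> Z) (Z \<otimes> X)" and b': "b' \<in> hom K (X \<otimes> Z') (Z' \<otimes> X)"
    and c: "c \<in> hom K (Y \<otimes> Z) (Z \<otimes> Y)" and c': "c' \<in> hom K (Y \<otimes> Z') (Z' \<otimes> Y)"
    and yb: "yang_baxter K X Y Z a b c" and yb': "yang_baxter K X Y Z' a b' c'"
  shows "yang_baxter K X Y (Z \<otimes> Z') a
    ((Z \<rhd> b') \<cdot> (b \<lhd> Z')) ((Z \<rhd> c') \<cdot> (c \<lhd> Z'))"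
proof -
  note [simp] = obj a[unfolded hom_iff] b[unfolded hom_iff] b'[unfolded hom_iff]
    c[unfolded hom_iff] c'[unfolded hom_iff]
  have "(((Z \<rhd> c') \<cdot> (c \<lhd> Z')) \<lhd> X) \<cdot> (Y \<rhd> ((Z \<rhd> b') \<cdot> (b \<lhd> Z'))) \<cdot> (a \<lhd> (Z \<otimes> Z'))
    = (Z \<rhd> (c' \<lhd> X)) \<cdot> ((c \<lhd> (Z' \<otimes> X)) \<cdot> ((Y \<otimes> Z) \<rhd> b')) \<cdot> (Y \<rhd> (b \<lhd> Z')) \<cdot> (a \<lhd> (Z \<otimes> Z'))"
    by simp
  also have "(c \<lhd> (Z' \<otimes> X)) \<cdot> ((Y \<otimes> Z) \<rhd> b') = ((Z \<otimes> Y) \<rhd> b') \<cdot> (c \<lhd> (X \<otimes> Z'))"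
    by (rule slide[symmetric]) fact+
  also have "(Z \<rhd> (c' \<lhd> X)) \<cdot> (((Z \<otimes> Y) \<rhd> b') \<cdot> (c \<lhd> (X \<otimes> Z'))) \<cdot> (Y \<rhd> (b \<lhd> Z')) \<cdot> (a \<lhd> (Z \<otimes> Z'))
    = (Z \<rhd> ((c' \<lhd> X) \<cdot> (Y \<rhd> b'))) \<cdot> (((c \<lhd> X) \<cdot> (Y \<rhd> b) \<cdot> (a \<lhd> Z)) \<lhd> Z')"
    by simp
  also have "(c \<lhd> X) \<cdot> (Y \<rhd> b) \<cdot> (a \<lhd> Z) = (Z \<rhd> a) \<cdot> (b \<lhd> Y) \<cdot> (X \<rhd> c)"
    using yb by (simp only: yang_baxter_def)
  also have "(Z \<rhd> ((c' \<lhd> X) \<cdot> (Y \<rhd> b'))) \<cdot> (((Z \<rhd> a) \<cdot> (b \<lhd> Y) \<cdot> (X \<rhd> c)) \<lhd> Z')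
    = (Z \<rhd> ((c' \<lhd> X) \<cdot> (Y \<rhd> b') \<cdot> (a \<lhd> Z'))) \<cdot> (((b \<lhd> Y) \<cdot> (X \<rhd> c)) \<lhd> Z')"
    by simp
  also have "(c' \<lhd> X) \<cdot> (Y \<rhd> b') \<cdot> (a \<lhd> Z') = (Z' \<rhd> a) \<cdot> (b' \<lhd> Y) \<cdot> (X \<rhd> c')"
    using yb' by (simp only: yang_baxter_def)
  also have "(Z \<rhd> ((Z' \<rhd> a) \<cdot> (b' \<lhd> Y) \<cdot> (X \<rhd> c'))) \<cdot> (((b \<lhd> Y) \<cdot> (X \<rhd> c)) \<lhd> Z')
    = ((Z \<otimes> Z') \<rhd> a) \<cdot> (Z \<rhd> (b' \<lhd> Y)) \<cdot> (((Z \<otimes> X) \<rhd> c') \<cdot> (b \<lhd> (Y \<otimes> Z'))) \<cdot> (X \<rhd> (c \<lhd> Z'))"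
    by simp
  also have "((Z \<otimes> X) \<rhd> c') \<cdot> (b \<lhd> (Y \<otimes> Z')) = (b \<lhd> (Z' \<otimes> Y)) \<cdot> ((X \<otimes> Z) \<rhd> c')"
    by (rule slide) fact+
  also have "((Z \<otimes> Z') \<rhd> a) \<cdot> (Z \<rhd> (b' \<lhd> Y)) \<cdot> ((b \<lhd> (Z' \<otimes> Y)) \<cdot> ((X \<otimes> Z) \<rhd> c')) \<cdot> (X \<rhd> (c \<lhd> Z'))
    = ((Z \<otimes> Z') \<rhd> a) \<cdot> (((Z \<rhd> b') \<cdot> (b \<lhd> Z')) \<lhd> Y) \<cdot> (X \<rhd> ((Z \<rhd> c') \<cdot> (c \<lhd> Z')))"
    by simp
  finally show ?thesis by (simp only: yang_baxter_def)
qed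

text \<open>
  Mirror image of the previous lemma: here \<open>c\<close> is pulled first through \<open>X\<close> and then through
  \<open>X'\<close>.
\<close>

lemma yang_baxter_first:
  assumes obj: "X \<in> Obj K" "X' \<in> Obj K" "Y \<in> Obj K" "Z \<in> Obj K"
    and a: "a \<in> hom K (X \<otimes> Y) (Y \<otimes> X)" and a': "a' \<in> hom K (X' \<otimes> Y) (Y \<otimes> X')"
    and b: "b \<in> hom K (X \<otimes> Z) (Z \<otimes> X)" and b': "b' \<in> hom K (X' \<otimes> Z) (Z \<otimes> X')"
    and c: "c \<in> hom K (Y \<otimes> Z) (Z \<otimes> Y)"
    and yb: "yang_baxter K X Y Z a b c" and yb': "yang_baxter K X' Y Z a' b' c"
  shows "yang_baxter K (X \<otimes> X') Y Z
    ((a \<lhd> X') \<cdot> (X \<rhd> a')) ((b \<lhd> X') \<cdot> (X \<rhd> b')) c"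
proof -
  note [simp] = obj a[unfolded hom_iff] a'[unfolded hom_iff] b[unfolded hom_iff]
    b'[unfolded hom_iff] c[unfolded hom_iff]
  have "(c \<lhd> (X \<otimes> X')) \<cdot> (Y \<rhd> ((b \<lhd> X') \<cdot> (X \<rhd> b'))) \<cdot> (((a \<lhd> X') \<cdot> (X \<rhd> a')) \<lhd> Z)
    = (c \<lhd> (X \<otimes> X')) \<cdot> (Y \<rhd> (b \<lhd> X')) \<cdot> (((Y \<otimes> X) \<rhd> b') \<cdot> (a \<lhd> (X' \<otimes> Z))) \<cdot> (X \<rhd> (a' \<lhd> Z))"
    by simp
  also have "((Y \<otimes> X) \<rhd> b') \<cdot> (a \<lhd> (X' \<otimes> Z)) = (a \<lhd> (Z \<otimes> X')) \<cdot> ((X \<otimes> Y) \<rhd> b')"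
    by (rule slide) fact+
  also have "(c \<lhd> (X \<otimes> X')) \<cdot> (Y \<rhd> (b \<lhd> X')) \<cdot> ((a \<lhd> (Z \<otimes> X')) \<cdot> ((X \<otimes> Y) \<rhd> b')) \<cdot> (X \<rhd> (a' \<lhd> Z))
    = (((c \<lhd> X) \<cdot> (Y \<rhd> b) \<cdot> (a \<lhd> Z)) \<lhd> X') \<cdot> (X \<rhd> ((Y \<rhd> b') \<cdot> (a' \<lhd> Z)))"
    by simp
  also have "(c \<lhd> X) \<cdot> (Y \<rhd> b) \<cdot> (a \<lhd> Z) = (Z \<rhd> a) \<cdot> (b \<lhd> Y) \<cdot> (X \<rhd> c)"
    using yb by (simp only: yang_baxter_def)
  also have "(((Z \<rhd> a) \<cdot> (b \<lhd> Y) \<cdot> (X \<rhd> c)) \<lhd> X') \<cdot> (X \<rhd> ((Y \<rhd> b') \<cdot> (a' \<lhd> Z)))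
    = (((Z \<rhd> a) \<cdot> (b \<lhd> Y)) \<lhd> X') \<cdot> (X \<rhd> ((c \<lhd> X') \<cdot> (Y \<rhd> b') \<cdot> (a' \<lhd> Z)))"
    by simp
  also have "(c \<lhd> X') \<cdot> (Y \<rhd> b') \<cdot> (a' \<lhd> Z) = (Z \<rhd> a') \<cdot> (b' \<lhd> Y) \<cdot> (X' \<rhd> c)"
    using yb' by (simp only: yang_baxter_def)
  also have "(((Z \<rhd> a) \<cdot> (b \<lhd> Y)) \<lhd> X') \<cdot> (X \<rhd> ((Z \<rhd> a') \<cdot> (b' \<lhd> Y) \<cdot> (X' \<rhd> c)))
    = (Z \<rhd> (a \<lhd> X')) \<cdot> ((b \<lhd> (Y \<otimes> X')) \<cdot> ((X \<otimes> Z) \<rhd> a')) \<cdot> (X \<rhd> (b' \<lhd> Y)) \<cdot> ((X \<otimes> X') \<rhd> c)"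
    by simp
  also have "(b \<lhd> (Y \<otimes> X')) \<cdot> ((X \<otimes> Z) \<rhd> a') = ((Z \<otimes> X) \<rhd> a') \<cdot> (b \<lhd> (X' \<otimes> Y))"
    by (rule slide[symmetric]) fact+
  also have "(Z \<rhd> (a \<lhd> X')) \<cdot> (((Z \<otimes> X) \<rhd> a') \<cdot> (b \<lhd> (X' \<otimes> Y))) \<cdot> (X \<rhd> (b' \<lhd> Y)) \<cdot> ((X \<otimes> X') \<rhd> c)
    = (Z \<rhd> ((a \<lhd> X') \<cdot> (X \<rhd> a'))) \<cdot> (((b \<lhd> X') \<cdot> (X \<rhd> b')) \<lhd> Y) \<cdot> ((X \<otimes> X') \<rhd> c)"
    by simp
  finally show ?thesis by (simp only: yang_baxter_def)
qed

text \<open>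
  Here the equation for \<open>Y'\<close> applies at once; it moves the crossing \<open>b\<close> of the outer strands to
  the other side of \<open>Y'\<close>. Two exchanges then bring \<open>b\<close> together with the crossings of \<open>Y\<close>.
\<close>

lemma yang_baxter_middle:
  assumes obj: "X \<in> Obj K" "Y \<in> Obj K" "Y' \<in> Obj K" "Z \<in> Obj K"
    and a: "a \<in> hom K (X \<otimes> Y) (Y \<otimes> X)" and a': "a' \<in> hom K (X \<otimes> Y') (Y' \<otimes> X)"
    and b: "b \<in> hom K (X \<otimes> Z) (Z \<otimes> X)"
    and c: "c \<in> hom K (Y \<otimes> Z) (Z \<otimes> Y)" and c': "c' \<in> hom K (Y' \<otimes> Z) (Z \<otimes> Y')"
    and yb: "yang_baxter K X Y Z a b c" and yb': "yang_baxter K X Y' Z a' b c'"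
  shows "yang_baxter K X (Y \<otimes> Y') Z
    ((Y \<rhd> a') \<cdot> (a \<lhd> Y')) b ((c \<lhd> Y') \<cdot> (Y \<rhd> c'))"
proof -
  note [simp] = obj a[unfolded hom_iff] a'[unfolded hom_iff] b[unfolded hom_iff]
    c[unfolded hom_iff] c'[unfolded hom_iff]
  have "(((c \<lhd> Y') \<cdot> (Y \<rhd> c')) \<lhd> X) \<cdot> ((Y \<otimes> Y') \<rhd> b) \<cdot> (((Y \<rhd> a') \<cdot> (a \<lhd> Y')) \<lhd> Z)
    = (c \<lhd> (Y' \<otimes> X)) \<cdot> (Y \<rhd> ((c' \<lhd> X) \<cdot> (Y' \<rhd> b) \<cdot> (a' \<lhd> Z))) \<cdot> (a \<lhd> (Y' \<otimes> Z))"
    by simp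
  also have "(c' \<lhd> X) \<cdot> (Y' \<rhd> b) \<cdot> (a' \<lhd> Z) = (Z \<rhd> a') \<cdot> (b \<lhd> Y') \<cdot> (X \<rhd> c')"
    using yb' by (simp only: yang_baxter_def)
  also have "(c \<lhd> (Y' \<otimes> X)) \<cdot> (Y \<rhd> ((Z \<rhd> a') \<cdot> (b \<lhd> Y') \<cdot> (X \<rhd> c'))) \<cdot> (a \<lhd> (Y' \<otimes> Z))
    = ((c \<lhd> (Y' \<otimes> X)) \<cdot> ((Y \<otimes> Z) \<rhd> a')) \<cdot> (Y \<rhd> (b \<lhd> Y')) \<cdot> (((Y \<otimes> X) \<rhd> c') \<cdot> (a \<lhd> (Y' \<otimes> Z)))"
    by simp
  also have "(c \<lhd> (Y' \<otimes> X)) \<cdot> ((Y \<otimes> Z) \<rhd> a') = ((Z \<otimes> Y) \<rhd> a') \<cdot> (c \<lhd> (X \<otimes> Y'))"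
    by (rule slide[symmetric]) fact+
  also have "((Y \<otimes> X) \<rhd> c') \<cdot> (a \<lhd> (Y' \<otimes> Z)) = (a \<lhd> (Z \<otimes> Y')) \<cdot> ((X \<otimes> Y) \<rhd> c')"
    by (rule slide) fact+
  also have "(((Z \<otimes> Y) \<rhd> a') \<cdot> (c \<lhd> (X \<otimes> Y'))) \<cdot> (Y \<rhd> (b \<lhd> Y')) \<cdot> ((a \<lhd> (Z \<otimes> Y')) \<cdot> ((X \<otimes> Y) \<rhd> c'))
    = ((Z \<otimes> Y) \<rhd> a') \<cdot> (((c \<lhd> X) \<cdot> (Y \<rhd> b) \<cdot> (a \<lhd> Z)) \<lhd> Y') \<cdot> ((X \<otimes> Y) \<rhd> c')"
    by simp
  also have "(c \<lhd> X) \<cdot> (Y \<rhd> b) \<cdot> (a \<lhd> Z) = (Z \<rhd> a) \<cdot> (b \<lhd> Y) \<cdot> (X \<rhd> c)"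
    using yb by (simp only: yang_baxter_def)
  also have "((Z \<otimes> Y) \<rhd> a') \<cdot> (((Z \<rhd> a) \<cdot> (b \<lhd> Y) \<cdot> (X \<rhd> c)) \<lhd> Y') \<cdot> ((X \<otimes> Y) \<rhd> c')
    = (Z \<rhd> ((Y \<rhd> a') \<cdot> (a \<lhd> Y'))) \<cdot> (b \<lhd> (Y \<otimes> Y')) \<cdot> (X \<rhd> ((c \<lhd> Y') \<cdot> (Y \<rhd> c')))"
    by simp
  finally show ?thesis by (simp only: yang_baxter_def)
qed

text \<open>
  A strand \<open>X\<close> that leaves the left factor through \<open>p\<close> (or \<open>q\<close>) and then crosses the right
  factor. With \<open>P = X \<otimes> M\<close> and \<open>h = X \<rhd> f\<close> this gives naturality of the braiding
  of \<open>C\<close> with a tensor product; with \<open>P = M\<close> and \<open>h = f\<close> it gives naturality of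
  the coaction on a tensor product.
\<close>

lemma tensor_natural_outgoing:
  assumes f: "f \<in> hom K M N" and g: "g \<in> hom K M' N'" and h: "h \<in> hom K P P'"
    and X: "X \<in> Obj K"
    and p: "p \<in> hom K P (M \<otimes> X)" and q: "q \<in> hom K P' (N \<otimes> X)"
    and p': "p' \<in> hom K (X \<otimes> M') (M' \<otimes> X)" and q': "q' \<in> hom K (X \<otimes> N') (N' \<otimes> X)"
    and nat: "(f \<lhd> X) \<cdot> p = q \<cdot> h" and nat': "(g \<lhd> X) \<cdot> p' = q' \<cdot> (X \<rhd> g)"
  shows "((f \<boxtimes> g) \<lhd> X) \<cdot> (M \<rhd> p') \<cdot> (p \<lhd> M') = ((N \<rhd> q') \<cdot> (q \<lhd> N')) \<cdot> (h \<boxtimes> g)"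
proof -
  note [simp] = X p[unfolded hom_iff] q[unfolded hom_iff] p'[unfolded hom_iff]
    q'[unfolded hom_iff] h[unfolded hom_iff]
  have [simp]: "f \<in> Arr K" "Dom K f = M" "Cod K f = N" "g \<in> Arr K" "Dom K g = M'" "Cod K g = N'"
    "M \<in> Obj K" "N \<in> Obj K" "M' \<in> Obj K" "N' \<in> Obj K"
    using f g Dom_in_Obj Cod_in_Obj by (auto simp add: hom_iff)
  have "((f \<boxtimes> g) \<lhd> X) \<cdot> (M \<rhd> p') \<cdot> (p \<lhd> M') = ((f \<boxtimes> (g \<lhd> X)) \<cdot> (M \<rhd> p')) \<cdot> (p \<lhd> M')"
    by simp
  also have "(f \<boxtimes> (g \<lhd> X)) \<cdot> (M \<rhd> p') = (N \<rhd> q') \<cdot> (f \<boxtimes> (X \<rhd> g))"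
    using nat' by (simp add: interchange)
  also have "f \<boxtimes> (X \<rhd> g) = (f \<lhd> X) \<boxtimes> g"
    by simp
  also have "((N \<rhd> q') \<cdot> ((f \<lhd> X) \<boxtimes> g)) \<cdot> (p \<lhd> M') = (N \<rhd> q') \<cdot> (((f \<lhd> X) \<boxtimes> g) \<cdot> (p \<lhd> M'))"
    by (rule Comp_assoc_Arr) (simp_all del: TensA_assoc)
  also have "((f \<lhd> X) \<boxtimes> g) \<cdot> (p \<lhd> M') = (q \<lhd> N') \<cdot> (h \<boxtimes> g)"
    using nat by (simp add: interchange del: TensA_assoc)
  finally show ?thesis by simp
qed

text \<open>
  The dual situation, a strand \<open>X\<close> that crosses the right factor and is then received by the left
  one: \<open>P = X \<otimes> M\<close> covers the braiding with \<open>A\<close>, and \<open>P = M\<close> covers actions.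
\<close>

lemma tensor_natural_incoming:
  assumes f: "f \<in> hom K M N" and g: "g \<in> hom K M' N'" and h: "h \<in> hom K P P'"
    and X: "X \<in> Obj K"
    and p: "p \<in> hom K (M \<otimes> X) P" and q: "q \<in> hom K (N \<otimes> X) P'"
    and p': "p' \<in> hom K (M' \<otimes> X) (X \<otimes> M')" and q': "q' \<in> hom K (N' \<otimes> X) (X \<otimes> N')"
    and nat: "h \<cdot> p = q \<cdot> (f \<lhd> X)" and nat': "(X \<rhd> g) \<cdot> p' = q' \<cdot> (g \<lhd> X)"
  shows "(h \<boxtimes> g) \<cdot> (p \<lhd> M') \<cdot> (M \<rhd> p') = ((q \<lhd> N') \<cdot> (N \<rhd> q')) \<cdot> ((f \<boxtimes> g) \<lhd> X)"
proof -
  note [simp] = X p[unfolded hom_iff] q[unfolded hom_iff] p'[unfolded hom_iff]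
    q'[unfolded hom_iff] h[unfolded hom_iff]
  have [simp]: "f \<in> Arr K" "Dom K f = M" "Cod K f = N" "g \<in> Arr K" "Dom K g = M'" "Cod K g = N'"
    "M \<in> Obj K" "N \<in> Obj K" "M' \<in> Obj K" "N' \<in> Obj K"
    using f g Dom_in_Obj Cod_in_Obj by (auto simp add: hom_iff)
  have "(h \<boxtimes> g) \<cdot> (p \<lhd> M') \<cdot> (M \<rhd> p') = ((h \<boxtimes> g) \<cdot> (p \<lhd> M')) \<cdot> (M \<rhd> p')"
    by simp
  also have "(h \<boxtimes> g) \<cdot> (p \<lhd> M') = (q \<lhd> N') \<cdot> ((f \<lhd> X) \<boxtimes> g)"
    using nat by (simp add: interchange del: TensA_assoc)
  also have "(f \<lhd> X) \<boxtimes> g = f \<boxtimes> (X \<rhd> g)"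
    by simp
  also have "((q \<lhd> N') \<cdot> (f \<boxtimes> (X \<rhd> g))) \<cdot> (M \<rhd> p') = (q \<lhd> N') \<cdot> ((f \<boxtimes> (X \<rhd> g)) \<cdot> (M \<rhd> p'))"
    by (rule Comp_assoc_Arr) simp_all
  also have "(f \<boxtimes> (X \<rhd> g)) \<cdot> (M \<rhd> p') = (N \<rhd> q') \<cdot> (f \<boxtimes> (g \<lhd> X))"
    using nat' by (simp add: interchange)
  finally show ?thesis by simp
qed

end


section \<open>Categories of structured objects\<close>

lemma category_prod_cat:
  assumes "category K" and "category L"
  shows "category (prod_cat K L)"
proof -
  interpret K: category K by fact
  interpret L: category L by fact
  show ?thesis
    by unfold_locales (auto simp add: prod_cat_def hom_def)
qed

text \<open>
  Objects of \<open>K\<close> with extra structure, whose morphisms are tagged morphisms of \<open>K\<close> that satisfy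
  a condition \<open>R\<close> stable under identities and composition. The categories of enriching structures
  and of Yetter-Drinfel'd modules are both of this kind, and all their laws are inherited from \<open>K\<close>.
\<close>

locale structured_category = category K
  for K :: "('o, 'm, 'z) cat_scheme" (structure) +
  fixes L :: "('x, ('x, 'm) mor, 'y) cat_scheme"
    and U :: "'x \<Rightarrow> 'o" and R :: "'x \<Rightarrow> 'm \<Rightarrow> 'x \<Rightarrow> bool"
  assumes Arr_L: "Arr L = {Mor x f y | x f y. x \<in> Obj L \<and> y \<in> Obj L \<and> R x f y}"
    and Dom_L: "Dom L = mor_src" and Cod_L: "Cod L = mor_tgt"
    and Ident_L: "Ident L = (\<lambda>x. Mor x (Ident K (U x)) x)"
    and Comp_L: "Comp L = (\<lambda>g f. Mor (mor_src f) (mor_und g \<cdot> mor_und f) (mor_tgt g))"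
    and U_Obj: "x \<in> Obj L \<Longrightarrow> U x \<in> Obj K"
    and R_hom: "\<lbrakk>x \<in> Obj L; y \<in> Obj L; R x f y\<rbrakk> \<Longrightarrow> f \<in> hom K (U x) (U y)"
    and R_Ident: "x \<in> Obj L \<Longrightarrow> R x (Ident K (U x)) x"
    and R_Comp: "\<lbrakk>x \<in> Obj L; y \<in> Obj L; z \<in> Obj L; R x f y; R y g z\<rbrakk> \<Longrightarrow> R x (g \<cdot> f) z"
begin

lemma hom_L_iff:
  "F \<in> hom L x y \<longleftrightarrow> x \<in> Obj L \<and> y \<in> Obj L \<and> (\<exists>f. F = Mor x f y \<and> R x f y)"
  by (auto simp add: hom_def Arr_L Dom_L Cod_L)

lemma category_L: "category L"
proof
  fix F G H w x y z
  show "F \<in> Arr L \<Longrightarrow> Dom L F \<in> Obj L" "F \<in> Arr L \<Longrightarrow> Cod L F \<in> Obj L"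
    by (auto simp add: Arr_L Dom_L Cod_L)
  show "x \<in> Obj L \<Longrightarrow> Ident L x \<in> hom L x x"
    by (simp add: hom_L_iff Ident_L R_Ident)
  show "\<lbrakk>F \<in> hom L x y; G \<in> hom L y z\<rbrakk> \<Longrightarrow> Comp L G F \<in> hom L x z"
    by (auto simp add: hom_L_iff Comp_L intro: R_Comp)
  show "F \<in> hom L x y \<Longrightarrow> Comp L (Ident L y) F = F"
    by (auto simp add: hom_L_iff Comp_L Ident_L intro: Ident_left[OF R_hom])
  show "F \<in> hom L x y \<Longrightarrow> Comp L F (Ident L x) = F"
    by (auto simp add: hom_L_iff Comp_L Ident_L intro: Ident_right[OF R_hom])
  assume "F \<in> hom L w x" "G \<in> hom L x y" "H \<in> hom L y z"
  then obtain f g h where FGH: "F = Mor w f x" "G = Mor x g y" "H = Mor y h z"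
    and "f \<in> hom K (U w) (U x)" "g \<in> hom K (U x) (U y)" "h \<in> hom K (U y) (U z)"
    using R_hom unfolding hom_L_iff by blast
  then show "Comp L (Comp L H G) F = Comp L H (Comp L G F)"
    by (simp add: Comp_L Comp_assoc)
qed

end

text \<open>
  Functoriality of an operation that is \<open>\<boxtimes>\<close> on underlying morphisms is the interchange law of \<open>K\<close>;
  only the compatibility of \<open>T\<close> with the structures is left to check. Both the tensor product of
  enriching structures and the functor \<open>E\<close> are instances.
\<close>

lemma (in strict_monoidal_category) tensor_lifts_to_bifunctor:
  assumes "structured_category K L1 U1 R1" "structured_category K L2 U2 R2"
    "structured_category K L3 U3 R3"
    and T_Obj: "\<And>x y. \<lbrakk>x \<in> Obj L1; y \<in> Obj L2\<rbrakk> \<Longrightarrow> T x y \<in> Obj L3"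
    and U_T: "\<And>x y. \<lbrakk>x \<in> Obj L1; y \<in> Obj L2\<rbrakk> \<Longrightarrow> U3 (T x y) = U1 x \<otimes> U2 y"
    and R_T: "\<And>x x' y y' f g. \<lbrakk>x \<in> Obj L1; x' \<in> Obj L1; y \<in> Obj L2; y' \<in> Obj L2;
      R1 x f x'; R2 y g y'\<rbrakk> \<Longrightarrow> R3 (T x y) (f \<boxtimes> g) (T x' y')"
  shows "bifunctor L1 L2 L3 T
    (\<lambda>F G. Mor (T (mor_src F) (mor_src G)) (mor_und F \<boxtimes> mor_und G) (T (mor_tgt F) (mor_tgt G)))"
proof -
  interpret L1: structured_category K L1 U1 R1 by fact
  interpret L2: structured_category K L2 U2 R2 by fact
  interpret L3: structured_category K L3 U3 R3 by fact
  let ?T = "\<lambda>F G. Mor (T (mor_src F) (mor_src G)) (mor_und F \<boxtimes> mor_und G)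
    (T (mor_tgt F) (mor_tgt G))"
  have hom_prod: "F \<in> hom (prod_cat L1 L2) x y \<longleftrightarrow>
      fst F \<in> hom L1 (fst x) (fst y) \<and> snd F \<in> hom L2 (snd x) (snd y)" for F x y
    by (cases F; cases x; cases y) (auto simp add: prod_cat_def hom_def)
  have Comp_prod: "Comp (prod_cat L1 L2) G F = (Comp L1 (fst G) (fst F), Comp L2 (snd G) (snd F))"
    for F G
    by (cases F; cases G) (simp add: prod_cat_def)
  have "cat_functor (prod_cat L1 L2) L3 (case_prod T) (case_prod ?T)"
  proof (intro cat_functor.intro cat_functor_axioms.intro)
    show "category (prod_cat L1 L2)"
      by (intro category_prod_cat L1.category_L L2.category_L)
    show "category L3" by (rule L3.category_L)
    fix F G x y z
    show "x \<in> Obj (prod_cat L1 L2) \<Longrightarrow> case_prod T x \<in> Obj L3"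
      by (auto simp add: prod_cat_def T_Obj)
    show "F \<in> hom (prod_cat L1 L2) x y \<Longrightarrow> case_prod ?T F \<in> hom L3 (case_prod T x) (case_prod T y)"
      by (cases F; cases x; cases y)
        (auto simp add: hom_prod L1.hom_L_iff L2.hom_L_iff L3.hom_L_iff T_Obj R_T)
    show "x \<in> Obj (prod_cat L1 L2) \<Longrightarrow>
        case_prod ?T (Ident (prod_cat L1 L2) x) = Ident L3 (case_prod T x)"
      by (auto simp add: prod_cat_def L1.Ident_L L2.Ident_L L3.Ident_L U_T L1.U_Obj L2.U_Obj)
    assume "F \<in> hom (prod_cat L1 L2) x y" "G \<in> hom (prod_cat L1 L2) y z"
    then obtain f f' g g' where
      F: "fst F = Mor (fst x) f (fst y)" "snd F = Mor (snd x) f' (snd y)"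
      and G: "fst G = Mor (fst y) g (fst z)" "snd G = Mor (snd y) g' (snd z)"
      and R: "R1 (fst x) f (fst y)" "R2 (snd x) f' (snd y)" "R1 (fst y) g (fst z)" "R2 (snd y) g' (snd z)"
      and obj: "fst x \<in> Obj L1" "fst y \<in> Obj L1" "fst z \<in> Obj L1"
        "snd x \<in> Obj L2" "snd y \<in> Obj L2" "snd z \<in> Obj L2"
      by (auto simp add: hom_prod L1.hom_L_iff L2.hom_L_iff)
    have "(g \<boxtimes> g') \<cdot> (f \<boxtimes> f') = (g \<cdot> f) \<boxtimes> (g' \<cdot> f')"
      using L1.R_hom[OF obj(1,2) R(1)] L2.R_hom[OF obj(4,5) R(2)]
        L1.R_hom[OF obj(2,3) R(3)] L2.R_hom[OF obj(5,6) R(4)]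
      by (intro interchange) (simp_all add: hom_iff)
    then show "case_prod ?T (Comp (prod_cat L1 L2) G F) = Comp L3 (case_prod ?T G) (case_prod ?T F)"
      by (simp add: Comp_prod case_prod_beta F G L1.Comp_L L2.Comp_L L3.Comp_L)
  qed
  then show ?thesis using L1.category_L L2.category_L by simp
qed


section \<open>Enriching structures and Yetter-Drinfel'd modules over a rank 2 braided system\<close>

text \<open>
  With nested bounded quantifiers, a concrete rank turns the definition into a finite conjunction.
\<close>

lemma braided_system_iff:
  "braided_system K r V \<sigma> \<longleftrightarrow>
    (\<forall>i\<in>{1..r}. V i \<in> Obj K) \<and>
    (\<forall>i\<in>{1..r}. \<forall>j\<in>{i..r}. \<sigma> i j \<in> hom K (V i \<otimes>\<^bsub>K\<^esub> V j) (V j \<otimes>\<^bsub>K\<^esub> V i)) \<and>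
    (\<forall>i\<in>{1..r}. \<forall>j\<in>{i..r}. \<forall>k\<in>{j..r}.
      yang_baxter K (V i) (V j) (V k) (\<sigma> i j) (\<sigma> i k) (\<sigma> j k))"
proof -
  have "(\<forall>i j. 1 \<le> i \<and> i \<le> j \<and> j \<le> r \<longrightarrow> P i j) \<longleftrightarrow> (\<forall>i\<in>{1..r}. \<forall>j\<in>{i..r}. P i j)"
    for P :: "nat \<Rightarrow> nat \<Rightarrow> bool"
    by (meson atLeastAtMost_iff order_trans)
  moreover have "(\<forall>i j k. 1 \<le> i \<and> i \<le> j \<and> j \<le> k \<and> k \<le> r \<longrightarrow> Q i j k) \<longleftrightarrow>
      (\<forall>i\<in>{1..r}. \<forall>j\<in>{i..r}. \<forall>k\<in>{j..r}. Q i j k)"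
    for Q :: "nat \<Rightarrow> nat \<Rightarrow> nat \<Rightarrow> bool"
    by (auto intro: order_trans)
  ultimately show ?thesis
    by (simp only: braided_system_def yang_baxter_def)
qed

text \<open>
  The lower bound \<open>1\<close> appears as \<open>Suc 0\<close>, the form to which the simplifier rewrites it.
\<close>

lemma small_intervals:
  "{Suc 0..3} = {1, 2, 3}" "{2..3} = {2, 3::nat}" "{Suc 0..2} = {1, 2}"
  by auto

lemma braided_system2_iff:
  "braided_system2 K C A \<sigma>CC \<sigma>AA \<sigma>CA \<longleftrightarrow>
    C \<in> Obj K \<and> A \<in> Obj K \<and>
    \<sigma>CC \<in> hom K (C \<otimes>\<^bsub>K\<^esub> C) (C \<otimes>\<^bsub>K\<^esub> C) \<and>
    \<sigma>CA \<in> hom K (C \<otimes>\<^bsub>K\<^esub> A) (A \<otimes>\<^bsub>K\<^esub> C) \<and>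
    \<sigma>AA \<in> hom K (A \<otimes>\<^bsub>K\<^esub> A) (A \<otimes>\<^bsub>K\<^esub> A) \<and>
    yang_baxter K C C C \<sigma>CC \<sigma>CC \<sigma>CC \<and> yang_baxter K C C A \<sigma>CC \<sigma>CA \<sigma>CA \<and>
    yang_baxter K C A A \<sigma>CA \<sigma>CA \<sigma>AA \<and> yang_baxter K A A A \<sigma>AA \<sigma>AA \<sigma>AA"
  by (simp add: braided_system2_def braided_system_iff small_intervals)

locale braided_pair = strict_monoidal_category K
  for K :: "('o, 'm, 'z) mon_cat_scheme" (structure) +
  fixes C A :: 'o and \<sigma>CC \<sigma>AA \<sigma>CA :: 'm
  assumes braided: "braided_system2 K C A \<sigma>CC \<sigma>AA \<sigma>CA"
begin

abbreviation enriching :: "('o, 'm) enr \<Rightarrow> bool" where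
  "enriching \<equiv> is_enriching K C A \<sigma>CC \<sigma>AA \<sigma>CA"

abbreviation yetter_drinfeld :: "('o, 'm) yd \<Rightarrow> bool" where
  "yetter_drinfeld \<equiv> is_yd K C A \<sigma>CC \<sigma>AA \<sigma>CA"

abbreviation Z_cat :: "(('o, 'm) enr, (('o, 'm) enr, 'm) mor) mon_cat" where
  "Z_cat \<equiv> enr_cat K C A \<sigma>CC \<sigma>AA \<sigma>CA"

abbreviation YD_cat :: "(('o, 'm) yd, (('o, 'm) yd, 'm) mor) cat" where
  "YD_cat \<equiv> yd_cat K C A \<sigma>CC \<sigma>AA \<sigma>CA"

lemma Z_cat_simps [simp]:
  "E \<in> Obj Z_cat \<longleftrightarrow> enriching E" "TensO Z_cat = enr_tensor K"
  "TensA Z_cat = (\<lambda>f g. Mor (enr_tensor K (mor_src f) (mor_src g)) (mor_und f \<boxtimes> mor_und g)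
    (enr_tensor K (mor_tgt f) (mor_tgt g)))"
  "TUnit Z_cat = Enr \<I> (Ident K C) (Ident K A)"
  by (simp_all add: enr_cat_def)

lemma YD_cat_simps [simp]: "Y \<in> Obj YD_cat \<longleftrightarrow> yetter_drinfeld Y"
  by (simp add: yd_cat_def)

lemma pair_Obj [simp]: "C \<in> Obj K" "A \<in> Obj K"
  and pair_hom: "\<sigma>CC \<in> hom K (C \<otimes> C) (C \<otimes> C)" "\<sigma>AA \<in> hom K (A \<otimes> A) (A \<otimes> A)"
    "\<sigma>CA \<in> hom K (C \<otimes> A) (A \<otimes> C)"
  and pair_yang_baxter: "yang_baxter K C C C \<sigma>CC \<sigma>CC \<sigma>CC" "yang_baxter K C C A \<sigma>CC \<sigma>CA \<sigma>CA"
    "yang_baxter K C A A \<sigma>CA \<sigma>CA \<sigma>AA" "yang_baxter K A A A \<sigma>AA \<sigma>AA \<sigma>AA"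
  using braided by (simp_all add: braided_system2_iff)

lemmas pair_Arr [simp] = pair_hom[unfolded hom_iff]

text \<open>
  The braid relations without \<open>M\<close> belong to the rank 2 system, and those with \<open>M\<close> in two or
  three positions become trivial because \<open>M\<close> crosses itself by the identity.
\<close>

lemma enriching_iff:
  "enriching E \<longleftrightarrow>
    enr_ob E \<in> Obj K \<and>
    enr_C E \<in> hom K (C \<otimes> enr_ob E) (enr_ob E \<otimes> C) \<and>
    enr_A E \<in> hom K (enr_ob E \<otimes> A) (A \<otimes> enr_ob E) \<and>
    yang_baxter K C C (enr_ob E) \<sigma>CC (enr_C E) (enr_C E) \<and>
    yang_baxter K C (enr_ob E) A (enr_C E) \<sigma>CA (enr_A E) \<and>
    yang_baxter K (enr_ob E) A A (enr_A E) (enr_A E) \<sigma>AA"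
proof -
  let ?M = "enr_ob E" and ?id = "Ident K (enr_ob E \<otimes> enr_ob E)"
  have self_crossing: "yang_baxter K C ?M ?M (enr_C E) (enr_C E) ?id"
    "yang_baxter K ?M ?M A ?id (enr_A E) (enr_A E)"
    "yang_baxter K ?M ?M ?M ?id ?id ?id" "?id \<in> hom K (?M \<otimes> ?M) (?M \<otimes> ?M)"
    if "?M \<in> Obj K" "enr_C E \<in> hom K (C \<otimes> ?M) (?M \<otimes> C)" "enr_A E \<in> hom K (?M \<otimes> A) (A \<otimes> ?M)"
  proof -
    note [simp] = that(1) that(2,3)[unfolded hom_iff]
    show "yang_baxter K C ?M ?M (enr_C E) (enr_C E) ?id" "yang_baxter K ?M ?M A ?id (enr_A E) (enr_A E)"
      "yang_baxter K ?M ?M ?M ?id ?id ?id" "?id \<in> hom K (?M \<otimes> ?M) (?M \<otimes> ?M)"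
      by (simp_all add: yang_baxter_def hom_iff flip: Ident_TensO)
  qed
  note iff_simps = is_enriching_def braided_system_iff small_intervals pair_hom pair_yang_baxter
  show ?thesis
  proof (cases "?M \<in> Obj K \<and> enr_C E \<in> hom K (C \<otimes> ?M) (?M \<otimes> C) \<and> enr_A E \<in> hom K (?M \<otimes> A) (A \<otimes> ?M)")
    case True
    with self_crossing show ?thesis
      by (simp add: iff_simps del: Ident_TensO)
  next
    case False
    then show ?thesis
      by (auto simp add: iff_simps simp del: Ident_TensO)
  qed
qed

lemma enriching_tensor:
  assumes "enriching E" "enriching E'"
  shows "enriching (enr_tensor K E E')"
  using assms pair_hom pair_yang_baxter
  by (auto simp add: enriching_iff enr_tensor_def
      intro!: yang_baxter_first yang_baxter_middle yang_baxter_third)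
    (auto simp add: hom_iff)

lemma enriching_unit: "enriching (Enr \<I> (Ident K C) (Ident K A))"
  by (simp add: enriching_iff hom_iff yang_baxter_def flip: Ident_TensO)

text \<open>
  The braid relations required of \<open>A\<close> and of \<open>C\<close> all occur among those of the rank 2 system.
\<close>

lemma enriching_A: "enriching (Enr A \<sigma>CA \<sigma>AA)"
  and enriching_C: "enriching (Enr C \<sigma>CC \<sigma>CA)"
  using pair_hom pair_yang_baxter by (simp_all add: enriching_iff)

lemma enr_mor_tensor:
  assumes "enriching E" "enriching E'" "enriching F" "enriching F'"
    and f: "is_enr_mor K C A E f F" and g: "is_enr_mor K C A E' g F'"
  shows "is_enr_mor K C A (enr_tensor K E E') (f \<boxtimes> g) (enr_tensor K F F')"
proof -
  note str = assms(1-4)[unfolded enriching_iff]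
  note mor = f[unfolded is_enr_mor_def] g[unfolded is_enr_mor_def]
  note [simp] = str[unfolded hom_iff] mor[unfolded hom_iff]
  have "((f \<boxtimes> g) \<lhd> C) \<cdot> (enr_ob E \<rhd> enr_C E') \<cdot> (enr_C E \<lhd> enr_ob E') =
      ((enr_ob F \<rhd> enr_C F') \<cdot> (enr_C F \<lhd> enr_ob F')) \<cdot> ((C \<rhd> f) \<boxtimes> g)"
    by (rule tensor_natural_outgoing[where P = "C \<otimes> enr_ob E" and P' = "C \<otimes> enr_ob F"])
      (use str mor in \<open>simp_all add: hom_iff\<close>)
  moreover have "((A \<rhd> f) \<boxtimes> g) \<cdot> (enr_A E \<lhd> enr_ob E') \<cdot> (enr_ob E \<rhd> enr_A E') =
      ((enr_A F \<lhd> enr_ob F') \<cdot> (enr_ob F \<rhd> enr_A F')) \<cdot> ((f \<boxtimes> g) \<lhd> A)"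
    by (rule tensor_natural_incoming[where P = "A \<otimes> enr_ob E" and P' = "A \<otimes> enr_ob F"])
      (use str mor in \<open>simp_all add: hom_iff\<close>)
  ultimately show ?thesis
    by (simp add: is_enr_mor_def enr_tensor_def hom_iff)
qed

lemma enr_tensor_unit:
  assumes "enriching E"
  shows "enr_tensor K (Enr \<I> (Ident K C) (Ident K A)) E = E"
    "enr_tensor K E (Enr \<I> (Ident K C) (Ident K A)) = E"
  using assms
  by (cases E; simp add: enriching_iff hom_iff enr_tensor_def flip: Ident_TensO)+

text \<open>
  Both bracketings move the three factors across \<open>C\<close> (or \<open>A\<close>) one at a time in the same order, so
  strictness of \<open>K\<close> gives equality of the structure morphisms.
\<close>

lemma enr_tensor_assoc:
  assumes "enriching E" "enriching F" "enriching G"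
  shows "enr_tensor K (enr_tensor K E F) G = enr_tensor K E (enr_tensor K F G)"
  using assms by (simp add: enriching_iff hom_iff enr_tensor_def)

lemma yd_structure:
  assumes "yetter_drinfeld Y"
  shows "yd_ob Y \<in> Obj K" "yd_act Y \<in> hom K (yd_ob Y \<otimes> A) (yd_ob Y)"
    "yd_coact Y \<in> hom K (yd_ob Y) (yd_ob Y \<otimes> C)"
  using assms by (simp_all add: is_yd_def Let_def)

text \<open>
  Each of the three computations slides the crossings with \<open>M\<close> past the structure maps of \<open>N\<close>, so
  that the axiom for \<open>N\<close> and one braid relation for \<open>M\<close> can be applied separately.
\<close>

lemma yetter_drinfeld_tensor:
  assumes Y: "yetter_drinfeld Y" and E: "enriching E"
  shows "yetter_drinfeld (yd_enr_ob K Y E)"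
proof -
  define N \<rho> \<delta> M p q where
    "N = yd_ob Y" "\<rho> = yd_act Y" "\<delta> = yd_coact Y" "M = enr_ob E" "p = enr_C E" "q = enr_A E"
  note defs = this
  have obj: "N \<in> Obj K" "M \<in> Obj K"
    and \<rho>: "\<rho> \<in> hom K (N \<otimes> A) N" and \<delta>: "\<delta> \<in> hom K N (N \<otimes> C)"
    and p: "p \<in> hom K (C \<otimes> M) (M \<otimes> C)" and q: "q \<in> hom K (M \<otimes> A) (A \<otimes> M)"
    and act: "\<rho> \<cdot> (\<rho> \<lhd> A) = \<rho> \<cdot> (\<rho> \<lhd> A) \<cdot> (N \<rhd> \<sigma>AA)"
    and coact: "(\<delta> \<lhd> C) \<cdot> \<delta> = (N \<rhd> \<sigma>CC) \<cdot> (\<delta> \<lhd> C) \<cdot> \<delta>"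
    and compat: "\<delta> \<cdot> \<rho> = (\<rho> \<lhd> C) \<cdot> (N \<rhd> \<sigma>CA) \<cdot> (\<delta> \<lhd> A)"
    and yb: "yang_baxter K C C M \<sigma>CC p p" "yang_baxter K C M A p \<sigma>CA q" "yang_baxter K M A A q q \<sigma>AA"
    using Y E by (simp_all add: defs is_yd_def Let_def enriching_iff)
  note [simp] = obj \<rho>[unfolded hom_iff] \<delta>[unfolded hom_iff] p[unfolded hom_iff] q[unfolded hom_iff]
  let ?\<rho> = "(\<rho> \<lhd> M) \<cdot> (N \<rhd> q)" and ?\<delta> = "(N \<rhd> p) \<cdot> (\<delta> \<lhd> M)"

  \<comment> \<open>The action axiom: acting twice on \<open>N \<otimes> M\<close> is moving both strands \<open>A\<close> through \<open>M\<close> and then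
    acting twice on \<open>N\<close>. A crossing \<open>\<sigma>AA\<close> created at \<open>N\<close> is pulled through \<open>M\<close> to the right.\<close>
  have "?\<rho> \<cdot> (?\<rho> \<lhd> A) = (\<rho> \<lhd> M) \<cdot> ((N \<rhd> q) \<cdot> (\<rho> \<lhd> (M \<otimes> A))) \<cdot> (N \<rhd> (q \<lhd> A))"
    by simp
  also have "(N \<rhd> q) \<cdot> (\<rho> \<lhd> (M \<otimes> A)) = (\<rho> \<lhd> (A \<otimes> M)) \<cdot> ((N \<otimes> A) \<rhd> q)"
    by (rule slide) fact+
  also have "(\<rho> \<lhd> M) \<cdot> ((\<rho> \<lhd> (A \<otimes> M)) \<cdot> ((N \<otimes> A) \<rhd> q)) \<cdot> (N \<rhd> (q \<lhd> A))
    = ((\<rho> \<cdot> (\<rho> \<lhd> A)) \<lhd> M) \<cdot> (N \<rhd> ((A \<rhd> q) \<cdot> (q \<lhd> A)))"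
    by simp
  finally have act_twice:
    "?\<rho> \<cdot> (?\<rho> \<lhd> A) = ((\<rho> \<cdot> (\<rho> \<lhd> A)) \<lhd> M) \<cdot> (N \<rhd> ((A \<rhd> q) \<cdot> (q \<lhd> A)))" .
  also have "\<dots> = ((\<rho> \<cdot> (\<rho> \<lhd> A) \<cdot> (N \<rhd> \<sigma>AA)) \<lhd> M) \<cdot> (N \<rhd> ((A \<rhd> q) \<cdot> (q \<lhd> A)))"
    by (subst act) (rule refl)
  also have "\<dots> = ((\<rho> \<cdot> (\<rho> \<lhd> A)) \<lhd> M) \<cdot> (N \<rhd> ((\<sigma>AA \<lhd> M) \<cdot> (A \<rhd> q) \<cdot> (q \<lhd> A)))"
    by simp
  also have "(\<sigma>AA \<lhd> M) \<cdot> (A \<rhd> q) \<cdot> (q \<lhd> A) = (A \<rhd> q) \<cdot> (q \<lhd> A) \<cdot> (M \<rhd> \<sigma>AA)"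
    using yb(3) by (simp only: yang_baxter_def)
  also have "((\<rho> \<cdot> (\<rho> \<lhd> A)) \<lhd> M) \<cdot> (N \<rhd> ((A \<rhd> q) \<cdot> (q \<lhd> A) \<cdot> (M \<rhd> \<sigma>AA)))
    = (((\<rho> \<cdot> (\<rho> \<lhd> A)) \<lhd> M) \<cdot> (N \<rhd> ((A \<rhd> q) \<cdot> (q \<lhd> A)))) \<cdot> ((N \<otimes> M) \<rhd> \<sigma>AA)"
    by simp
  also note act_twice[symmetric]
  also have "(?\<rho> \<cdot> (?\<rho> \<lhd> A)) \<cdot> ((N \<otimes> M) \<rhd> \<sigma>AA) = ?\<rho> \<cdot> (?\<rho> \<lhd> A) \<cdot> ((N \<otimes> M) \<rhd> \<sigma>AA)"
    by (rule Comp_assoc_Arr) simp_all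
  finally have act': "?\<rho> \<cdot> (?\<rho> \<lhd> A) = ?\<rho> \<cdot> (?\<rho> \<lhd> A) \<cdot> ((N \<otimes> M) \<rhd> \<sigma>AA)" .

  \<comment> \<open>The coaction axiom, with the crossing \<open>\<sigma>CC\<close> again created at \<open>N\<close>.\<close>
  have "(?\<delta> \<lhd> C) \<cdot> ?\<delta> = (N \<rhd> (p \<lhd> C)) \<cdot> ((\<delta> \<lhd> (M \<otimes> C)) \<cdot> (N \<rhd> p)) \<cdot> (\<delta> \<lhd> M)"
    by simp
  also have "(\<delta> \<lhd> (M \<otimes> C)) \<cdot> (N \<rhd> p) = ((N \<otimes> C) \<rhd> p) \<cdot> (\<delta> \<lhd> (C \<otimes> M))"
    by (rule slide[symmetric]) fact+
  also have "(N \<rhd> (p \<lhd> C)) \<cdot> (((N \<otimes> C) \<rhd> p) \<cdot> (\<delta> \<lhd> (C \<otimes> M))) \<cdot> (\<delta> \<lhd> M)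
    = (N \<rhd> ((p \<lhd> C) \<cdot> (C \<rhd> p))) \<cdot> (((\<delta> \<lhd> C) \<cdot> \<delta>) \<lhd> M)"
    by simp
  finally have coact_twice:
    "(?\<delta> \<lhd> C) \<cdot> ?\<delta> = (N \<rhd> ((p \<lhd> C) \<cdot> (C \<rhd> p))) \<cdot> (((\<delta> \<lhd> C) \<cdot> \<delta>) \<lhd> M)" .
  also have "\<dots> = (N \<rhd> ((p \<lhd> C) \<cdot> (C \<rhd> p))) \<cdot> (((N \<rhd> \<sigma>CC) \<cdot> (\<delta> \<lhd> C) \<cdot> \<delta>) \<lhd> M)"
    by (subst coact) (rule refl)
  also have "\<dots> = (N \<rhd> ((p \<lhd> C) \<cdot> (C \<rhd> p) \<cdot> (\<sigma>CC \<lhd> M))) \<cdot> (((\<delta> \<lhd> C) \<cdot> \<delta>) \<lhd> M)"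
    by simp
  also have "(p \<lhd> C) \<cdot> (C \<rhd> p) \<cdot> (\<sigma>CC \<lhd> M) = (M \<rhd> \<sigma>CC) \<cdot> (p \<lhd> C) \<cdot> (C \<rhd> p)"
    using yb(1) by (simp only: yang_baxter_def)
  also have "(N \<rhd> ((M \<rhd> \<sigma>CC) \<cdot> (p \<lhd> C) \<cdot> (C \<rhd> p))) \<cdot> (((\<delta> \<lhd> C) \<cdot> \<delta>) \<lhd> M)
    = ((N \<otimes> M) \<rhd> \<sigma>CC) \<cdot> ((N \<rhd> ((p \<lhd> C) \<cdot> (C \<rhd> p))) \<cdot> (((\<delta> \<lhd> C) \<cdot> \<delta>) \<lhd> M))"
    by simp
  also note coact_twice[symmetric]
  finally have coact': "(?\<delta> \<lhd> C) \<cdot> ?\<delta> = ((N \<otimes> M) \<rhd> \<sigma>CC) \<cdot> (?\<delta> \<lhd> C) \<cdot> ?\<delta>" .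

  \<comment> \<open>Compatibility: exchanging action and coaction on \<open>N\<close> creates a crossing \<open>\<sigma>CA\<close> to the left of
    \<open>M\<close>, which the braid relation of shape \<open>C M A\<close> moves to its right.\<close>
  have "?\<delta> \<cdot> ?\<rho> = (N \<rhd> p) \<cdot> ((\<delta> \<cdot> \<rho>) \<lhd> M) \<cdot> (N \<rhd> q)"
    by simp
  also note compat
  also have "(N \<rhd> p) \<cdot> (((\<rho> \<lhd> C) \<cdot> (N \<rhd> \<sigma>CA) \<cdot> (\<delta> \<lhd> A)) \<lhd> M) \<cdot> (N \<rhd> q)
    = ((N \<rhd> p) \<cdot> (\<rho> \<lhd> (C \<otimes> M))) \<cdot> (N \<rhd> (\<sigma>CA \<lhd> M)) \<cdot> ((\<delta> \<lhd> (A \<otimes> M)) \<cdot> (N \<rhd> q))"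
    by simp
  also have "(N \<rhd> p) \<cdot> (\<rho> \<lhd> (C \<otimes> M)) = (\<rho> \<lhd> (M \<otimes> C)) \<cdot> ((N \<otimes> A) \<rhd> p)"
    by (rule slide) fact+
  also have "(\<delta> \<lhd> (A \<otimes> M)) \<cdot> (N \<rhd> q) = ((N \<otimes> C) \<rhd> q) \<cdot> (\<delta> \<lhd> (M \<otimes> A))"
    by (rule slide[symmetric]) fact+
  also have "((\<rho> \<lhd> (M \<otimes> C)) \<cdot> ((N \<otimes> A) \<rhd> p)) \<cdot> (N \<rhd> (\<sigma>CA \<lhd> M)) \<cdot> (((N \<otimes> C) \<rhd> q) \<cdot> (\<delta> \<lhd> (M \<otimes> A)))
    = (\<rho> \<lhd> (M \<otimes> C)) \<cdot> (N \<rhd> ((A \<rhd> p) \<cdot> (\<sigma>CA \<lhd> M) \<cdot> (C \<rhd> q))) \<cdot> (\<delta> \<lhd> (M \<otimes> A))"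
    by simp
  also have "(A \<rhd> p) \<cdot> (\<sigma>CA \<lhd> M) \<cdot> (C \<rhd> q) = (q \<lhd> C) \<cdot> (M \<rhd> \<sigma>CA) \<cdot> (p \<lhd> A)"
    using yb(2) by (simp only: yang_baxter_def)
  also have "(\<rho> \<lhd> (M \<otimes> C)) \<cdot> (N \<rhd> ((q \<lhd> C) \<cdot> (M \<rhd> \<sigma>CA) \<cdot> (p \<lhd> A))) \<cdot> (\<delta> \<lhd> (M \<otimes> A))
    = (?\<rho> \<lhd> C) \<cdot> ((N \<otimes> M) \<rhd> \<sigma>CA) \<cdot> (?\<delta> \<lhd> A)"
    by simp
  finally have compat': "?\<delta> \<cdot> ?\<rho> = (?\<rho> \<lhd> C) \<cdot> ((N \<otimes> M) \<rhd> \<sigma>CA) \<cdot> (?\<delta> \<lhd> A)" .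

  have homs: "?\<rho> \<in> hom K ((N \<otimes> M) \<otimes> A) (N \<otimes> M)" "?\<delta> \<in> hom K (N \<otimes> M) ((N \<otimes> M) \<otimes> C)"
    by (simp_all add: hom_iff)
  show ?thesis
    unfolding is_yd_def yd_enr_ob_def Let_def yd.sel defs[symmetric]
    by (intro conjI TensO_Obj obj homs act' coact' compat')
qed

lemma yd_mor_tensor:
  assumes "yetter_drinfeld Y" "yetter_drinfeld Y'" "enriching E" "enriching E'"
    and f: "is_yd_mor K C A Y f Y'" and g: "is_enr_mor K C A E g E'"
  shows "is_yd_mor K C A (yd_enr_ob K Y E) (f \<boxtimes> g) (yd_enr_ob K Y' E')"
proof -
  note str = yd_structure[OF assms(1)] yd_structure[OF assms(2)] assms(3,4)[unfolded enriching_iff]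
  note mor = f[unfolded is_yd_mor_def] g[unfolded is_enr_mor_def]
  note [simp] = str[unfolded hom_iff] mor[unfolded hom_iff]
  have "((f \<boxtimes> g) \<lhd> C) \<cdot> (yd_ob Y \<rhd> enr_C E) \<cdot> (yd_coact Y \<lhd> enr_ob E) =
      ((yd_ob Y' \<rhd> enr_C E') \<cdot> (yd_coact Y' \<lhd> enr_ob E')) \<cdot> (f \<boxtimes> g)"
    by (rule tensor_natural_outgoing[where P = "yd_ob Y" and P' = "yd_ob Y'"])
      (use str mor in \<open>simp_all add: hom_iff\<close>)
  moreover have "(f \<boxtimes> g) \<cdot> (yd_act Y \<lhd> enr_ob E) \<cdot> (yd_ob Y \<rhd> enr_A E) =
      ((yd_act Y' \<lhd> enr_ob E') \<cdot> (yd_ob Y' \<rhd> enr_A E')) \<cdot> ((f \<boxtimes> g) \<lhd> A)"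
    by (rule tensor_natural_incoming[where P = "yd_ob Y" and P' = "yd_ob Y'"])
      (use str mor in \<open>simp_all add: hom_iff\<close>)
  ultimately show ?thesis
    by (simp add: is_yd_mor_def yd_enr_ob_def hom_iff)
qed

text \<open>
  Pasting of commuting squares; it makes compatibility with a structure map stable under composition.
\<close>

lemma square_paste:
  assumes "f \<in> hom K X Y" "g \<in> hom K Y Z" "f' \<in> hom K X' Y'" "g' \<in> hom K Y' Z'"
    and "a \<in> hom K X X'" "b \<in> hom K Y Y'" "c \<in> hom K Z Z'"
    and "f' \<cdot> a = b \<cdot> f" "g' \<cdot> b = c \<cdot> g"
  shows "(g' \<cdot> f') \<cdot> a = c \<cdot> (g \<cdot> f)"
proof -
  have "(g' \<cdot> f') \<cdot> a = g' \<cdot> (b \<cdot> f)"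
    using Comp_assoc[OF assms(5,3,4)] assms(8) by simp
  also have "\<dots> = (c \<cdot> g) \<cdot> f"
    using Comp_assoc[OF assms(1,6,4)] assms(9) by simp
  also have "\<dots> = c \<cdot> (g \<cdot> f)"
    by (rule Comp_assoc) fact+
  finally show ?thesis .
qed

lemma structured_enr_cat: "structured_category K Z_cat enr_ob (is_enr_mor K C A)"
proof
  fix E F G f g
  assume "E \<in> Obj Z_cat" "F \<in> Obj Z_cat" "G \<in> Obj Z_cat"
    and fg: "is_enr_mor K C A E f F" "is_enr_mor K C A F g G"
  then have "enriching E" "enriching F" "enriching G"
    by simp_all
  note str = this[unfolded enriching_iff]
  note mor = fg[unfolded is_enr_mor_def]
  note [simp] = str[unfolded hom_iff] mor[THEN conjunct1, unfolded hom_iff]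
  have "((g \<lhd> C) \<cdot> (f \<lhd> C)) \<cdot> enr_C E = enr_C G \<cdot> ((C \<rhd> g) \<cdot> (C \<rhd> f))"
    by (rule square_paste[where b = "enr_C F"]) (use mor in \<open>auto simp add: hom_iff\<close>)
  moreover have "((A \<rhd> g) \<cdot> (A \<rhd> f)) \<cdot> enr_A E = enr_A G \<cdot> ((g \<lhd> A) \<cdot> (f \<lhd> A))"
    by (rule square_paste[where b = "enr_A F"]) (use mor in \<open>auto simp add: hom_iff\<close>)
  ultimately show "is_enr_mor K C A E (g \<cdot> f) G"
    by (simp add: is_enr_mor_def hom_iff)
next
  fix E assume "E \<in> Obj Z_cat"
  then show "is_enr_mor K C A E (Ident K (enr_ob E)) E"
    by (simp add: is_enr_mor_def enriching_iff hom_iff flip: Ident_TensO)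
qed (auto simp add: enr_cat_def is_enr_mor_def enriching_iff)

lemma structured_yd_cat: "structured_category K YD_cat yd_ob (is_yd_mor K C A)"
proof
  fix X Y Z f g
  assume "X \<in> Obj YD_cat" "Y \<in> Obj YD_cat" "Z \<in> Obj YD_cat"
    and fg: "is_yd_mor K C A X f Y" "is_yd_mor K C A Y g Z"
  then have "yetter_drinfeld X" "yetter_drinfeld Y" "yetter_drinfeld Z"
    by simp_all
  note str = this[THEN yd_structure(1)] this[THEN yd_structure(2)] this[THEN yd_structure(3)]
  note mor = fg[unfolded is_yd_mor_def]
  note [simp] = str[unfolded hom_iff] mor[THEN conjunct1, unfolded hom_iff]
  have "(g \<cdot> f) \<cdot> yd_act X = yd_act Z \<cdot> ((g \<lhd> A) \<cdot> (f \<lhd> A))"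
    by (rule square_paste[where b = "yd_act Y"]) (use mor in \<open>auto simp add: hom_iff\<close>)
  moreover have "((g \<lhd> C) \<cdot> (f \<lhd> C)) \<cdot> yd_coact X = yd_coact Z \<cdot> (g \<cdot> f)"
    by (rule square_paste[where b = "yd_coact Y"]) (use mor in \<open>auto simp add: hom_iff\<close>)
  ultimately show "is_yd_mor K C A X (g \<cdot> f) Z"
    by (simp add: is_yd_mor_def hom_iff)
next
  fix Y assume "Y \<in> Obj YD_cat"
  then have "yetter_drinfeld Y" by simp
  from yd_structure[OF this] show "is_yd_mor K C A Y (Ident K (yd_ob Y)) Y"
    by (simp add: is_yd_mor_def hom_iff flip: Ident_TensO)
qed (auto simp add: yd_cat_def is_yd_mor_def is_yd_def Let_def)

lemma strict_monoidal_enr_cat: "strict_monoidal_category Z_cat"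
proof -
  interpret Z: structured_category K Z_cat enr_ob "is_enr_mor K C A"
    by (rule structured_enr_cat)
  have bif: "bifunctor Z_cat Z_cat Z_cat (TensO Z_cat) (TensA Z_cat)"
    unfolding Z_cat_simps
    by (rule tensor_lifts_to_bifunctor[OF structured_enr_cat structured_enr_cat structured_enr_cat])
      (simp_all add: enriching_tensor enr_mor_tensor, simp add: enr_tensor_def)
  show ?thesis
  proof (intro strict_monoidal_category.intro strict_monoidal_category_axioms.intro
      Z.category_L bif)
    show "TUnit Z_cat \<in> Obj Z_cat"
      by (simp add: enriching_unit)
  qed (auto simp add: enr_cat_def enr_tensor_unit enr_tensor_assoc is_enr_mor_def hom_iff)
qed

lemma tensor_list_enriching:
  assumes "\<And>E. E \<in> set Es \<Longrightarrow> E \<in> Obj Z_cat"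
  shows "tensor_list Z_cat Es \<in> Obj Z_cat"
  using assms
  by (induction Es) (auto simp add: tensor_list_def enriching_unit enriching_tensor)

lemma yd_enr_bifunctor: "bifunctor YD_cat Z_cat YD_cat (yd_enr_ob K) (yd_enr_ar K)"
proof -
  have "yd_enr_ar K = (\<lambda>F G. Mor (yd_enr_ob K (mor_src F) (mor_src G)) (mor_und F \<boxtimes> mor_und G)
      (yd_enr_ob K (mor_tgt F) (mor_tgt G)))"
    by (intro ext) (simp add: yd_enr_ar_def)
  moreover have "bifunctor YD_cat Z_cat YD_cat (yd_enr_ob K) \<dots>"
    by (rule tensor_lifts_to_bifunctor[OF structured_yd_cat structured_enr_cat structured_yd_cat])
      (simp_all add: yetter_drinfeld_tensor yd_mor_tensor, simp add: yd_enr_ob_def)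
  ultimately show ?thesis by simp
qed

end

theorem proposition5p3:
  fixes K :: "('o, 'm) mon_cat"
    and C A :: 'o
    and \<sigma>CC \<sigma>AA \<sigma>CA :: 'm
  assumes "strict_monoidal_category K"
    and "braided_system2 K C A \<sigma>CC \<sigma>AA \<sigma>CA"
  shows "strict_monoidal_category (enr_cat K C A \<sigma>CC \<sigma>AA \<sigma>CA)
    \<and> (Enr A \<sigma>CA \<sigma>AA \<in> Obj (enr_cat K C A \<sigma>CC \<sigma>AA \<sigma>CA)
      \<and> Enr C \<sigma>CC \<sigma>CA \<in> Obj (enr_cat K C A \<sigma>CC \<sigma>AA \<sigma>CA)
      \<and> (\<forall>Es. set Es \<subseteq> {Enr A \<sigma>CA \<sigma>AA, Enr C \<sigma>CC \<sigma>CA} \<longrightarrow>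
           tensor_list (enr_cat K C A \<sigma>CC \<sigma>AA \<sigma>CA) Es \<in> Obj (enr_cat K C A \<sigma>CC \<sigma>AA \<sigma>CA)))
    \<and> bifunctor (yd_cat K C A \<sigma>CC \<sigma>AA \<sigma>CA) (enr_cat K C A \<sigma>CC \<sigma>AA \<sigma>CA)
        (yd_cat K C A \<sigma>CC \<sigma>AA \<sigma>CA) (yd_enr_ob K) (yd_enr_ar K)"
proof -
  interpret strict_monoidal_category K by fact
  interpret braided_pair K C A \<sigma>CC \<sigma>AA \<sigma>CA by unfold_locales fact
  have gen: "Enr A \<sigma>CA \<sigma>AA \<in> Obj Z_cat" "Enr C \<sigma>CC \<sigma>CA \<in> Obj Z_cat"
    by (simp_all add: enriching_A enriching_C)
  then have "tensor_list Z_cat Es \<in> Obj Z_cat" if "set Es \<subseteq> {Enr A \<sigma>CA \<sigma>AA, Enr C \<sigma>CC \<sigma>CA}" for Es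
    using that by (intro tensor_list_enriching) auto
  with gen show ?thesis
    using strict_monoidal_enr_cat yd_enr_bifunctor by blast
qed

end
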